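(* Let $r\ge0$ be an integer, and let $G_r(z,v)=\sum_{\tau} z^{|\tau|} v^{|\rho^r(\tau)|}$, the sum over all Catalan--Stanley trees $\tau$, where $|\cdot|$ denotes the number of nodes. Then, with $T=T(z)=\frac{1-\sqrt{1-4z}}{2}$ and $S(z,t)=z+\frac{zt}{1-t-T(z)^2}$, \[ G_r(z,v) = \frac{1}{1 - z\,\frac{1-T^{2r}}{1-T^{2}}}\; S\bigg(zv,\; \frac{z\,T^{2r}}{1 - z\,\frac{1-T^{2r}}{1-T^{2}}}\,v\bigg), \] where in $S(zv,\cdot)$ the function $T$ inside $S$ is evaluated at the first argument $zv$.
   Context: A rooted plane tree has ordered children at every node. For each child $c$ of the root, the rightmost leaf of the branch at $c$ is the leaf reached from $c$ by repeatedly moving to the rightmost child. A Catalan--Stanley tree is a rooted plane tree in which every such rightmost leaf has odd distance to the root (the one-node tree is included). $S(z,t)$ is the generating function of Catalan--Stanley trees with $t$ marking these rightmost leaves and $z$ marking all other nodes. The reduction $\rho$: for each rightmost leaf $\ell$ of a branch attached to the root, if $\ell$ is a child of the root it is deleted; otherwise all descendants of the grandparent of $\ell$ are deleted (the grandparent becomes a leaf); the one-node tree is mapped to itself. $\rho^r(\tau)$ is called the $r$-fold reduced tree ($r$th ancestor) of $\tau$. $T(z)$ is the generating function of rooted plane trees by number of nodes. *)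

theory Defs
  imports Complex_Main "HOL-Computational_Algebra.Formal_Power_Series"
begin

datatype ptree = Node "ptree list"

primrec children :: "ptree \<Rightarrow> ptree list" where
  "children (Node ts) = ts"

fun nodes :: "ptree \<Rightarrow> nat" where
  "nodes (Node ts) = Suc (\<Sum>t\<leftarrow>ts. nodes t)"

text \<open>Distance from the root of a tree to the leaf reached by always moving to the rightmost child.\<close>

function rightmost_dist :: "ptree \<Rightarrow> nat" where
  "rightmost_dist (Node ts) = (if ts = [] then 0 else Suc (rightmost_dist (last ts)))"
  by pat_completeness auto
termination
  by (relation "measure size") (auto dest!: last_in_set intro: size_list_estimation' simp: less_Suc_eq_le)

definition catalan_stanley :: "ptree \<Rightarrow> bool" where
  "catalan_stanley t \<longleftrightarrow> (\<forall>c \<in> set (children t). odd (Suc (rightmost_dist c)))"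

text \<open>\<open>cut c\<close> turns the grandparent of the rightmost leaf of the branch \<open>c\<close> into a leaf. In a
  Catalan--Stanley tree a branch \<open>c\<close> other than a single leaf has \<open>rightmost_dist c \<ge> 2\<close>, so
  that the grandparent belongs to \<open>c\<close>; the values of \<open>cut\<close> on other trees are irrelevant.\<close>

function cut :: "ptree \<Rightarrow> ptree" where
  "cut (Node ts) =
     (if rightmost_dist (Node ts) \<le> 2 then Node []
      else Node (butlast ts @ [cut (last ts)]))"
  by pat_completeness auto
termination
  by (relation "measure size")
    (auto dest!: last_in_set intro: size_list_estimation' simp: less_Suc_eq_le split: if_splits)

definition reduce :: "ptree \<Rightarrow> ptree" where
  "reduce t = Node (map cut (filter (\<lambda>c. c \<noteq> Node []) (children t)))"

text \<open>Bivariate generating functions live in \<open>\<real>[[v]][[z]]\<close>: the outer series variable is \<open>z\<close>, the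
  inner one is \<open>v\<close>.\<close>

abbreviation z_var :: "real fps fps" where
  "z_var \<equiv> fps_X"

abbreviation v_var :: "real fps fps" where
  "v_var \<equiv> fps_const fps_X"

text \<open>The coefficient of \<open>z\<^sup>n\<close> is a sum over the trees with \<open>n\<close> nodes, a finite set by
  \<open>finite_nodes_eq\<close> below.\<close>

definition G :: "nat \<Rightarrow> real fps fps" where
  "G r = Abs_fps (\<lambda>n. \<Sum>t | catalan_stanley t \<and> nodes t = n. fps_X ^ nodes ((reduce ^^ r) t))"

definition T_series :: "real fps" where
  "T_series = (1 - fps_radical root 2 (1 - 4 * fps_X)) / 2"

text \<open>Substitution of \<open>x\<close>, a bivariate series without constant term in \<open>z\<close>, for the variable
  of \<open>T_series\<close>.\<close>

definition T :: "real fps fps \<Rightarrow> real fps fps" where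
  "T x = fps_compose (Abs_fps (\<lambda>n. fps_const (fps_nth T_series n))) x"

text \<open>All quotients occurring here and in the main statement have denominators with constant
  term \<open>1\<close> in \<open>z\<close>, so that \<open>/\<close> is multiplication with the inverse series.\<close>

definition S :: "real fps fps \<Rightarrow> real fps fps \<Rightarrow> real fps fps" where
  "S x t = x + x * t / (1 - t - (T x)\<^sup>2)"

lemma finite_nodes_le: "finite {t. nodes t \<le> n}"
proof (induction n)
  case 0
  have "\<not> nodes t \<le> 0" for t by (cases t) auto
  then have "{t. nodes t \<le> 0} = {}" by blast
  then show ?case by (simp only: finite.emptyI)
next
  case (Suc n)
  have pos: "1 \<le> nodes t" for t by (cases t) auto
  have len: "length ts \<le> (\<Sum>t\<leftarrow>ts. nodes t)" for ts
  proof (induction ts)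
    case (Cons a ts)
    then show ?case using pos[of a] by simp
  qed simp
  have "{t. nodes t \<le> Suc n} \<subseteq> Node ` {ts. set ts \<subseteq> {t. nodes t \<le> n} \<and> length ts \<le> n}"
  proof
    fix t assume t: "t \<in> {t. nodes t \<le> Suc n}"
    obtain ts where ts: "t = Node ts" by (cases t)
    have s: "(\<Sum>t\<leftarrow>ts. nodes t) \<le> n" using t ts by simp
    have "nodes u \<le> n" if "u \<in> set ts" for u
      using member_le_sum_list[of "nodes u" "map nodes ts"] that s by simp
    then show "t \<in> Node ` {ts. set ts \<subseteq> {t. nodes t \<le> n} \<and> length ts \<le> n}"
      using ts s len[of ts] by auto
  qed
  moreover have "finite (Node ` {ts. set ts \<subseteq> {t. nodes t \<le> n} \<and> length ts \<le> n})"
    by (intro finite_imageI finite_lists_length_le Suc.IH)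
  ultimately show ?case by (rule finite_subset)
qed

lemma finite_nodes_eq: "finite {t. catalan_stanley t \<and> nodes t = n}"
  by (rule finite_subset[OF _ finite_nodes_le[of n]]) auto

end

theory Submission imports Defs begin

text \<open>Appending a branch \<open>c\<close> to the right of a tree \<open>t\<close> is a bijection from pairs of trees to
  trees with more than one node. It adds up node counts and raises the rightmost distance of \<open>c\<close>
  by one, so each class of trees involved satisfies a linear or quadratic equation. Iterated
  reduction acts on the branches independently: a branch with even rightmost distance \<open>d\<close> vanishes
  under \<open>\<rho>\<^sup>r\<close> if \<open>d < 2r\<close>, and otherwise loses the lowest \<open>2r\<close> levels of its rightmost path. The
  vanishing branches contribute \<open>V = z (1 - T\<^sup>2\<^sup>r) / (1 - T\<^sup>2)\<close> and the surviving ones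
  \<open>W = z v T\<^sup>2\<^sup>r / (1 - T(zv)\<^sup>2)\<close>, because the deleted part of the rightmost path is counted by
  \<open>T\<^sup>2\<^sup>r\<close> and the remaining part by even powers of \<open>T(zv)\<close>. Hence \<open>G = z v + G (V + W)\<close>.\<close>

section \<open>Formal power series\<close>

lemma fps_divide_eq_iff:
  fixes f g h :: "'a::{comm_ring_1,inverse} fps"
  assumes "fps_nth g 0 * inverse (fps_nth g 0) = 1"
  shows "f / g = h \<longleftrightarrow> f = h * g"
proof -
  have "fps_nth g 0 \<noteq> 0"
    using assms by auto
  then have "f / g = f * inverse g"
    by (rule fps_divide_unit)
  moreover have "g * inverse g = 1"
    using fps_right_inverse[OF assms] by (simp add: fps_inverse_def)
  ultimately show ?thesis
    by (metis mult.assoc mult.commute mult.right_neutral)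
qed

lemma fps_quadratic_unique:
  fixes f g :: "'a::idom fps"
  assumes "f = h + f\<^sup>2" "g = h + g\<^sup>2" "fps_nth f 0 = 0" "fps_nth g 0 = 0"
  shows "f = g"
proof -
  have "f - g = f\<^sup>2 - g\<^sup>2"
    using assms(1,2) by (metis add_diff_cancel_left)
  then have "(f - g) * (1 - f - g) = 0"
    by (simp add: algebra_simps power2_eq_square)
  moreover have "fps_nth (1 - f - g) 0 = 1"
    using assms(3,4) by simp
  then have "1 - f - g \<noteq> 0"
    by force
  ultimately show ?thesis
    by simp
qed

definition lift_fps :: "'a::zero fps \<Rightarrow> 'a fps fps" where
  "lift_fps f = Abs_fps (\<lambda>n. fps_const (fps_nth f n))"

lemma lift_fps_nth: "fps_nth (lift_fps f) n = fps_const (fps_nth f n)"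
  by (simp add: lift_fps_def)

lemma lift_fps_X: "lift_fps (fps_X :: 'a::zero_neq_one fps) = fps_X"
  by (rule fps_ext) (simp add: lift_fps_nth)

lemma lift_fps_add: "lift_fps (f + g :: 'a::monoid_add fps) = lift_fps f + lift_fps g"
  by (rule fps_ext) (simp add: lift_fps_nth)

lemma lift_fps_mult: "lift_fps (f * g :: 'a::semiring_0 fps) = lift_fps f * lift_fps g"
proof (rule fps_ext)
  show "fps_nth (lift_fps (f * g)) n = fps_nth (lift_fps f * lift_fps g) n" for n
    using sum_comp_morphism[of fps_const "\<lambda>i. fps_nth f i * fps_nth g (n - i)" "{0..n}"]
    by (simp add: lift_fps_nth fps_mult_nth comp_def)
qed

section \<open>Appending a rightmost branch\<close>

definition append_branch :: "ptree \<Rightarrow> ptree \<Rightarrow> ptree" where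
  "append_branch t c = Node (children t @ [c])"

definition append_branches :: "ptree set \<Rightarrow> ptree set \<Rightarrow> ptree set" where
  "append_branches A B = (\<lambda>(t, c). append_branch t c) ` (A \<times> B)"

lemma append_branch_induct [case_names leaf append_branch]:
  assumes leaf: "P (Node [])"
    and append_branch: "\<And>t c. P t \<Longrightarrow> P c \<Longrightarrow> P (append_branch t c)"
  shows "P t"
proof (induction t)
  case (Node ts)
  then show ?case
  proof (induction ts rule: rev_induct)
    case (snoc c ts)
    then show ?case
      using append_branch[of "Node ts" c] by (simp add: append_branch_def)
  qed (rule leaf)
qed

lemma tree_set_eqI:
  assumes "Node [] \<in> A \<longleftrightarrow> Node [] \<in> B"
    and "\<And>t c. append_branch t c \<in> A \<longleftrightarrow> append_branch t c \<in> B"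
  shows "A = B"
proof (rule set_eqI)
  show "t \<in> A \<longleftrightarrow> t \<in> B" for t
    by (induction t rule: append_branch_induct) (simp_all add: assms)
qed

lemma append_branch_neq_leaf [simp]:
  "append_branch t c \<noteq> Node []" "Node [] \<noteq> append_branch t c"
  by (auto simp: append_branch_def)

lemma append_branch_inject [simp]:
  "append_branch s b = append_branch t c \<longleftrightarrow> s = t \<and> b = c"
  by (cases s; cases t) (auto simp: append_branch_def)

lemma append_branch_in_append_branches_iff [simp]:
  "append_branch t c \<in> append_branches A B \<longleftrightarrow> t \<in> A \<and> c \<in> B"
  by (auto simp: append_branches_def)

lemma leaf_notin_append_branches [simp]: "Node [] \<notin> append_branches A B"
  by (auto simp: append_branches_def)

lemma append_branches_disjoint:
  "B \<inter> C = {} \<Longrightarrow> append_branches A B \<inter> append_branches A C = {}"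
  by (auto simp: append_branches_def)

lemma nodes_append_branch [simp]: "nodes (append_branch t c) = nodes t + nodes c"
  by (cases t) (simp add: append_branch_def)

lemma nodes_pos [simp]: "0 < nodes t"
  by (cases t) simp

lemma rightmost_dist_append_branch [simp]:
  "rightmost_dist (append_branch t c) = Suc (rightmost_dist c)"
  by (simp add: append_branch_def)

lemma rightmost_dist_eq_0_iff [simp]: "rightmost_dist t = 0 \<longleftrightarrow> t = Node []"
  by (induction t rule: append_branch_induct) simp_all

lemma catalan_stanley_leaf [simp]: "catalan_stanley (Node [])"
  by (simp add: catalan_stanley_def)

lemma catalan_stanley_append_branch [simp]:
  "catalan_stanley (append_branch t c) \<longleftrightarrow> catalan_stanley t \<and> even (rightmost_dist c)"
  by (auto simp: catalan_stanley_def append_branch_def)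

section \<open>Iterated reduction\<close>

lemma cut_append_branch:
  "cut (append_branch t c) =
    (if rightmost_dist c \<le> 1 then Node [] else append_branch t (cut c))"
  by (simp add: append_branch_def)

lemma rightmost_dist_cut: "rightmost_dist (cut c) = rightmost_dist c - 2"
  by (induction c rule: append_branch_induct) (auto simp: cut_append_branch)

lemma rightmost_dist_cut_funpow:
  "rightmost_dist ((cut ^^ r) c) = rightmost_dist c - 2 * r"
  by (induction r) (auto simp: rightmost_dist_cut)

lemma cut_funpow_append_branch:
  "2 * r \<le> rightmost_dist c \<Longrightarrow> (cut ^^ r) (append_branch t c) = append_branch t ((cut ^^ r) c)"
  by (induction r) (auto simp: cut_append_branch rightmost_dist_cut_funpow)

lemma cut_funpow_eq_leaf_iff: "(cut ^^ r) c = Node [] \<longleftrightarrow> rightmost_dist c \<le> 2 * r"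
  by (simp flip: rightmost_dist_eq_0_iff add: rightmost_dist_cut_funpow)

lemma reduce_leaf: "reduce (Node []) = Node []"
  by (simp add: reduce_def)

lemma reduce_funpow_leaf [simp]: "(reduce ^^ r) (Node []) = Node []"
  by (induction r) (simp_all add: reduce_leaf)

lemma reduce_append_branch:
  "reduce (append_branch t c) =
    (if c = Node [] then reduce t else append_branch (reduce t) (cut c))"
  by (simp add: reduce_def append_branch_def)

lemma reduce_funpow_append_branch:
  "even (rightmost_dist c) \<Longrightarrow> (reduce ^^ r) (append_branch t c) =
    (if 2 * r \<le> rightmost_dist c then append_branch ((reduce ^^ r) t) ((cut ^^ r) c)
     else (reduce ^^ r) t)"
proof (induction r arbitrary: t c)
  case (Suc r)
  show ?case
  proof (cases "c = Node []")
    case False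
    then have "rightmost_dist c \<noteq> 0" by simp
    then have "2 \<le> rightmost_dist c" using Suc.prems by presburger
    with False Suc show ?thesis
      by (auto simp: funpow_Suc_right reduce_append_branch rightmost_dist_cut
          simp del: funpow.simps)
  qed (simp add: funpow_Suc_right reduce_append_branch del: funpow.simps)
qed simp

definition vanishing_branches :: "nat \<Rightarrow> ptree set" where
  "vanishing_branches r = {c. even (rightmost_dist c) \<and> rightmost_dist c < 2 * r}"

definition surviving_branches :: "nat \<Rightarrow> ptree set" where
  "surviving_branches r = {c. even (rightmost_dist c) \<and> 2 * r \<le> rightmost_dist c}"

lemma vanishing_branches_0: "vanishing_branches 0 = {}"
  by (simp add: vanishing_branches_def)

lemma vanishing_branches_Suc:
  "vanishing_branches (Suc r) = vanishing_branches r \<union> {c. rightmost_dist c = 2 * r}"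
  by (auto simp: vanishing_branches_def; presburger)

lemma surviving_branches_decompose:
  "surviving_branches r = {c. rightmost_dist c = 2 * r} \<union>
    append_branches UNIV (append_branches UNIV (surviving_branches r))"
proof (rule tree_set_eqI)
  fix t c
  show "append_branch t c \<in> surviving_branches r \<longleftrightarrow>
      append_branch t c \<in> {c. rightmost_dist c = 2 * r} \<union>
        append_branches UNIV (append_branches UNIV (surviving_branches r))"
    by (induction c rule: append_branch_induct) (auto simp: surviving_branches_def; presburger)+
qed (auto simp: surviving_branches_def)

lemma catalan_stanley_decompose:
  "Collect catalan_stanley = {Node []} \<union>
    (append_branches (Collect catalan_stanley) (vanishing_branches r) \<union>
     append_branches (Collect catalan_stanley) (surviving_branches r))"
  by (rule tree_set_eqI) (auto simp: vanishing_branches_def surviving_branches_def)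

section \<open>Weighted generating functions of classes of trees\<close>

definition trees_of_size :: "ptree set \<Rightarrow> nat \<Rightarrow> ptree set" where
  "trees_of_size A n = {t \<in> A. nodes t = n}"

definition tree_gf :: "(ptree \<Rightarrow> 'a::semiring_1) \<Rightarrow> ptree set \<Rightarrow> 'a fps" where
  "tree_gf w A = Abs_fps (\<lambda>n. \<Sum>t\<in>trees_of_size A n. w t)"

lemma finite_trees_of_size [simp]: "finite (trees_of_size A n)"
  by (rule finite_subset[OF _ finite_nodes_le[of n]]) (auto simp: trees_of_size_def)

lemma trees_of_size_0 [simp]: "trees_of_size A 0 = {}"
  by (simp add: trees_of_size_def less_imp_neq[symmetric])

lemma trees_of_size_Un: "trees_of_size (A \<union> B) n = trees_of_size A n \<union> trees_of_size B n"
  by (auto simp: trees_of_size_def)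

lemma trees_of_size_leaf: "trees_of_size {Node []} n = (if n = 1 then {Node []} else {})"
  by (auto simp: trees_of_size_def)

lemma bij_betw_append_branch:
  "bij_betw (\<lambda>(_, t, c). append_branch t c)
    (SIGMA i:{0..n}. trees_of_size A i \<times> trees_of_size B (n - i))
    (trees_of_size (append_branches A B) n)"
  unfolding bij_betw_def inj_on_def
  by (force simp: trees_of_size_def append_branches_def image_iff)

lemma tree_gf_nth_0: "fps_nth (tree_gf w A) 0 = 0"
  by (simp add: tree_gf_def)

lemma tree_gf_cong: "(\<And>t. t \<in> A \<Longrightarrow> w t = w' t) \<Longrightarrow> tree_gf w A = tree_gf w' A"
  unfolding tree_gf_def
  by (intro arg_cong[of _ _ Abs_fps] ext sum.cong) (auto simp: trees_of_size_def)

lemma tree_gf_scale: "tree_gf (\<lambda>t. x * w t) A = fps_const x * tree_gf w A"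
  by (rule fps_ext) (simp add: tree_gf_def sum_distrib_left)

lemma tree_gf_empty: "tree_gf w {} = 0"
  by (rule fps_ext) (simp add: tree_gf_def trees_of_size_def)

lemma tree_gf_leaf: "tree_gf w {Node []} = fps_X * fps_const (w (Node []))"
  by (rule fps_ext) (simp add: tree_gf_def trees_of_size_leaf)

lemma tree_gf_Un_disjoint:
  assumes "A \<inter> B = {}"
  shows "tree_gf w (A \<union> B) = tree_gf w A + tree_gf w B"
proof (rule fps_ext)
  fix n
  have "trees_of_size A n \<inter> trees_of_size B n = {}"
    using assms by (auto simp: trees_of_size_def)
  then show "fps_nth (tree_gf w (A \<union> B)) n = fps_nth (tree_gf w A + tree_gf w B) n"
    by (simp add: tree_gf_def trees_of_size_Un sum.union_disjoint)
qed

lemma tree_gf_append_branches: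
  assumes weight: "\<And>t c. t \<in> A \<Longrightarrow> c \<in> B \<Longrightarrow> w (append_branch t c) = w\<^sub>1 t * w\<^sub>2 c"
  shows "tree_gf w (append_branches A B) = tree_gf w\<^sub>1 A * tree_gf w\<^sub>2 B"
proof (rule fps_ext)
  fix n
  let ?pairs = "SIGMA i:{0..n}. trees_of_size A i \<times> trees_of_size B (n - i)"
  have "fps_nth (tree_gf w\<^sub>1 A * tree_gf w\<^sub>2 B) n = (\<Sum>(_, t, c)\<in>?pairs. w\<^sub>1 t * w\<^sub>2 c)"
    by (simp add: fps_mult_nth tree_gf_def sum_product sum.cartesian_product sum.Sigma)
  also have "\<dots> = (\<Sum>p\<in>?pairs. w ((\<lambda>(_, t, c). append_branch t c) p))"
    by (rule sum.cong) (auto simp: trees_of_size_def weight)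
  also have "\<dots> = fps_nth (tree_gf w (append_branches A B)) n"
    by (simp add: tree_gf_def sum.reindex_bij_betw[OF bij_betw_append_branch])
  finally show "fps_nth (tree_gf w (append_branches A B)) n =
      fps_nth (tree_gf w\<^sub>1 A * tree_gf w\<^sub>2 B) n" ..
qed

section \<open>The series of all plane trees\<close>

lemma T_series_nth_0: "fps_nth T_series 0 = 0"
  by (simp add: T_series_def fps_divide_unit numeral_fps_const fps_const_inverse)

lemma T_series_quadratic: "T_series = fps_X + T_series\<^sup>2"
proof -
  define R :: "real fps" where "R = fps_radical root 2 (1 - 4 * fps_X)"
  have "R\<^sup>2 = 1 - 4 * fps_X"
    using power_radical[of "1 - 4 * fps_X :: real fps" root 1]
    by (simp add: R_def numeral_2_eq_2)
  moreover have "1 - R = T_series * 2"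
    using fps_divide_eq_iff[of 2 "1 - R" T_series]
    by (simp add: T_series_def R_def numeral_fps_const)
  then have "R = 1 - 2 * T_series"
    by (simp add: algebra_simps)
  ultimately have "4 * T_series = 4 * (fps_X + T_series\<^sup>2)"
    by (simp add: power2_eq_square algebra_simps)
  moreover have "(4 :: real fps) \<noteq> 0"
    by simp
  ultimately show ?thesis
    by (metis mult_left_cancel)
qed

lemma T_quadratic:
  assumes "fps_nth x 0 = 0"
  shows "T x = x + (T x)\<^sup>2"
proof -
  have T_eq: "T x = fps_compose (lift_fps T_series) x"
    by (simp add: T_def lift_fps_def)
  have "lift_fps T_series = lift_fps (fps_X + T_series\<^sup>2)"
    using T_series_quadratic by (rule arg_cong)
  also have "\<dots> = fps_X + lift_fps T_series * lift_fps T_series"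
    by (simp add: lift_fps_add lift_fps_X power2_eq_square lift_fps_mult)
  finally show ?thesis
    using assms unfolding T_eq power2_eq_square
    by (metis fps_compose_add_distrib fps_compose_mult_distrib fps_X_fps_compose_startby0)
qed

lemma T_nth_0: "fps_nth (T x) 0 = 0"
  by (simp add: T_def T_series_nth_0)

lemma tree_gf_UNIV:
  fixes x :: "real fps"
  shows "tree_gf (\<lambda>t. x ^ nodes t) UNIV = T (fps_X * fps_const x)"
proof (rule fps_quadratic_unique)
  let ?w = "\<lambda>t. x ^ nodes t"
  have "(UNIV :: ptree set) = {Node []} \<union> append_branches UNIV UNIV"
    by (rule tree_set_eqI) simp_all
  then have "tree_gf ?w UNIV = tree_gf ?w ({Node []} \<union> append_branches UNIV UNIV)"
    by (rule arg_cong)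
  also have "\<dots> = fps_X * fps_const x + (tree_gf ?w UNIV)\<^sup>2"
    by (subst tree_gf_Un_disjoint) (simp_all add: tree_gf_leaf power2_eq_square power_add
        tree_gf_append_branches[where w\<^sub>1 = ?w and w\<^sub>2 = ?w])
  finally show "tree_gf ?w UNIV = fps_X * fps_const x + (tree_gf ?w UNIV)\<^sup>2" .
qed (simp_all add: T_quadratic[symmetric] T_nth_0 tree_gf_nth_0)

section \<open>The series of branches\<close>

lemma tree_gf_rightmost_dist_eq:
  fixes x :: "real fps"
  shows "tree_gf (\<lambda>c. x ^ nodes c) {c. rightmost_dist c = k} =
    fps_X * fps_const x * T (fps_X * fps_const x) ^ k"
proof (induction k)
  case (Suc k)
  let ?w = "\<lambda>t. x ^ nodes t"
  have "{c. rightmost_dist c = Suc k} = append_branches UNIV {c. rightmost_dist c = k}"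
    by (rule tree_set_eqI) simp_all
  then show ?case
    by (simp add: tree_gf_append_branches[where w\<^sub>1 = ?w and w\<^sub>2 = ?w] power_add
        Suc tree_gf_UNIV mult.left_commute)
qed (simp add: tree_gf_leaf)

definition vanishing_gf :: "nat \<Rightarrow> real fps fps" where
  "vanishing_gf r = tree_gf (\<lambda>_. 1) (vanishing_branches r)"

definition surviving_gf :: "nat \<Rightarrow> real fps \<Rightarrow> real fps fps" where
  "surviving_gf r x = tree_gf (\<lambda>c. x ^ nodes ((cut ^^ r) c)) (surviving_branches r)"

lemma vanishing_gf_eq_sum: "vanishing_gf r = fps_X * (\<Sum>j<r. ((T fps_X)\<^sup>2) ^ j)"
proof (induction r)
  case 0
  show ?case
    by (simp add: vanishing_gf_def vanishing_branches_0 tree_gf_empty)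
next
  case (Suc r)
  have "vanishing_branches r \<inter> {c. rightmost_dist c = 2 * r} = {}"
    by (auto simp: vanishing_branches_def)
  then have "vanishing_gf (Suc r) =
      vanishing_gf r + tree_gf (\<lambda>_. 1) {c. rightmost_dist c = 2 * r}"
    by (simp add: vanishing_gf_def vanishing_branches_Suc tree_gf_Un_disjoint)
  then show ?case
    using tree_gf_rightmost_dist_eq[of 1 "2 * r"] by (simp add: Suc power_mult distrib_left)
qed

lemma vanishing_gf_eq:
  "vanishing_gf r = fps_X * ((1 - T fps_X ^ (2 * r)) / (1 - (T fps_X)\<^sup>2))"
proof -
  have "1 - T fps_X ^ (2 * r) = (\<Sum>j<r. ((T fps_X)\<^sup>2) ^ j) * (1 - (T fps_X)\<^sup>2)"
    using one_diff_power_eq[of "(T fps_X)\<^sup>2" r] by (metis power_mult mult.commute)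
  then have "(1 - T fps_X ^ (2 * r)) / (1 - (T fps_X)\<^sup>2) = (\<Sum>j<r. ((T fps_X)\<^sup>2) ^ j)"
    by (subst fps_divide_eq_iff) (simp_all add: T_nth_0 power2_eq_square)
  then show ?thesis
    by (simp add: vanishing_gf_eq_sum)
qed

lemma tree_gf_cut_funpow_append_branches:
  fixes x :: "real fps"
  assumes "\<And>c. c \<in> A \<Longrightarrow> 2 * r \<le> rightmost_dist c"
  shows "tree_gf (\<lambda>c. x ^ nodes ((cut ^^ r) c)) (append_branches UNIV A) =
    T (fps_X * fps_const x) * tree_gf (\<lambda>c. x ^ nodes ((cut ^^ r) c)) A"
  unfolding tree_gf_UNIV[symmetric] using assms
  by (intro tree_gf_append_branches) (simp add: cut_funpow_append_branch power_add)

lemma surviving_gf_linear_equation: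
  "surviving_gf r x =
    fps_X * fps_const x * T fps_X ^ (2 * r) + (T (fps_X * fps_const x))\<^sup>2 * surviving_gf r x"
proof -
  let ?w = "\<lambda>c. x ^ nodes ((cut ^^ r) c)"
  let ?shortest = "{c. rightmost_dist c = 2 * r}"
  let ?longer = "append_branches UNIV (append_branches UNIV (surviving_branches r))"
  have dist_surviving: "2 * r \<le> rightmost_dist c" if "c \<in> surviving_branches r" for c
    using that by (simp add: surviving_branches_def)
  then have dist_append_surviving: "2 * r \<le> rightmost_dist c"
    if "c \<in> append_branches UNIV (surviving_branches r)" for c
    using that by (force simp: append_branches_def)
  have "surviving_gf r x = tree_gf ?w (?shortest \<union> ?longer)"
    unfolding surviving_gf_def by (rule arg_cong[OF surviving_branches_decompose])
  also have "\<dots> = tree_gf ?w ?shortest + tree_gf ?w ?longer"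
    by (rule tree_gf_Un_disjoint) (auto simp: append_branches_def surviving_branches_def)
  also have "tree_gf ?w ?shortest = tree_gf (\<lambda>_. x * 1) ?shortest"
    by (rule tree_gf_cong) (simp add: cut_funpow_eq_leaf_iff[THEN iffD2])
  also have "\<dots> = fps_X * fps_const x * T fps_X ^ (2 * r)"
    unfolding tree_gf_scale using tree_gf_rightmost_dist_eq[of 1 "2 * r"] by (simp add: mult_ac)
  also have "tree_gf ?w ?longer = (T (fps_X * fps_const x))\<^sup>2 * surviving_gf r x"
    using dist_surviving dist_append_surviving
    by (simp add: tree_gf_cut_funpow_append_branches surviving_gf_def power2_eq_square mult.assoc)
  finally show ?thesis .
qed

lemma G_linear_equation:
  "G r = z_var * v_var + G r * (vanishing_gf r + surviving_gf r fps_X)"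
proof -
  let ?w = "\<lambda>t. (fps_X :: real fps) ^ nodes ((reduce ^^ r) t)"
  let ?vanishing = "append_branches (Collect catalan_stanley) (vanishing_branches r)"
  let ?surviving = "append_branches (Collect catalan_stanley) (surviving_branches r)"
  have disjoint: "?vanishing \<inter> ?surviving = {}"
    by (intro append_branches_disjoint)
      (auto simp: vanishing_branches_def surviving_branches_def)
  have G_eq: "G r = tree_gf ?w (Collect catalan_stanley)"
    by (simp add: G_def tree_gf_def trees_of_size_def)
  also have "\<dots> = tree_gf ?w ({Node []} \<union> (?vanishing \<union> ?surviving))"
    by (rule arg_cong[OF catalan_stanley_decompose])
  also have "\<dots> = tree_gf ?w {Node []} + (tree_gf ?w ?vanishing + tree_gf ?w ?surviving)"
    by (subst tree_gf_Un_disjoint) (simp_all add: tree_gf_Un_disjoint disjoint)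
  also have "tree_gf ?w {Node []} = z_var * v_var"
    by (simp add: tree_gf_leaf)
  also have "tree_gf ?w ?vanishing = G r * vanishing_gf r"
    unfolding G_eq vanishing_gf_def
    by (rule tree_gf_append_branches) (simp add: vanishing_branches_def reduce_funpow_append_branch)
  also have "tree_gf ?w ?surviving = G r * surviving_gf r fps_X"
    unfolding G_eq surviving_gf_def
    by (rule tree_gf_append_branches)
      (simp add: surviving_branches_def reduce_funpow_append_branch power_add)
  finally show ?thesis
    by (simp only: distrib_left)
qed

section \<open>Solving for the generating function\<close>

lemma S_eq_iff:
  assumes "fps_nth t 0 = 0"
  shows "S x t = f \<longleftrightarrow> f * (1 - t - (T x)\<^sup>2) = x * (1 - (T x)\<^sup>2)"
proof -
  have "S x t = f \<longleftrightarrow> x * t / (1 - t - (T x)\<^sup>2) = f - x"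
    by (auto simp: S_def)
  also have "\<dots> \<longleftrightarrow> x * t = (f - x) * (1 - t - (T x)\<^sup>2)"
    using assms by (intro fps_divide_eq_iff) (simp add: T_nth_0 power2_eq_square)
  also have "\<dots> \<longleftrightarrow> f * (1 - t - (T x)\<^sup>2) = x * (1 - (T x)\<^sup>2)"
    by (auto simp: algebra_simps)
  finally show ?thesis .
qed

lemma S_eq_mult_of_linear_system:
  assumes t_nth_0: "fps_nth t 0 = 0"
    and w_eq: "w * (1 - (T x)\<^sup>2) = t * D"
    and g_eq: "g * (D - w) = x"
  shows "S x t = g * D"
proof -
  have "g * D * (1 - t - (T x)\<^sup>2) = g * (D * (1 - (T x)\<^sup>2) - t * D)"
    by (simp add: algebra_simps)
  also have "\<dots> = g * (D - w) * (1 - (T x)\<^sup>2)"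
    unfolding w_eq [symmetric] by (simp add: algebra_simps)
  finally show ?thesis
    using S_eq_iff[OF t_nth_0] by (simp add: g_eq)
qed

theorem mainTheorem6:
  fixes r :: nat
  shows "G r =
    1 / (1 - z_var * ((1 - T z_var ^ (2 * r)) / (1 - (T z_var)\<^sup>2)))
    * S (z_var * v_var)
        (z_var * T z_var ^ (2 * r)
           / (1 - z_var * ((1 - T z_var ^ (2 * r)) / (1 - (T z_var)\<^sup>2)))
         * v_var)"
proof -
  define D where "D = 1 - vanishing_gf r"
  define x where "x = z_var * v_var"
  define t where "t = z_var * T z_var ^ (2 * r) / D * v_var"
  have D_nth_0: "fps_nth D 0 = 1"
    by (simp add: D_def vanishing_gf_eq)
  have divide_D_mult: "f / D * D = f" for f
    using fps_divide_eq_iff[of D f "f / D"] D_nth_0 by simp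
  have t_nth_0: "fps_nth t 0 = 0"
    using D_nth_0 by (simp add: t_def fps_divide_unit)
  have "t * D = x * T z_var ^ (2 * r)"
    using divide_D_mult[of "z_var * T z_var ^ (2 * r)"] by (simp add: t_def x_def mult_ac)
  then have "surviving_gf r fps_X * (1 - (T x)\<^sup>2) = t * D"
    using surviving_gf_linear_equation[of r fps_X] by (simp add: x_def algebra_simps)
  moreover have "G r * (D - surviving_gf r fps_X) = x"
    using G_linear_equation[of r] by (simp add: D_def x_def algebra_simps)
  ultimately have "S x t = G r * D"
    by (rule S_eq_mult_of_linear_system[OF t_nth_0])
  then have "G r = 1 / D * S x t"
    using divide_D_mult[of 1] by (simp add: mult.left_commute mult.commute[of _ D])
  then show ?thesis
    by (simp add: D_def t_def x_def vanishing_gf_eq)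
qed

end
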